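(* Let $X$ be a 1-walk regular graph. Then for any two edges $e$ and $f$ of $X$, the graphs $X\backslash e$ and $X\backslash f$ are cospectral with respect to the adjacency matrix.
   Context: A graph is 1-walk regular if for every positive integer $k$ the number of closed walks of length $k$ at a vertex is the same for all vertices, and the number of walks of length $k$ from $u$ to $v$ is the same for all pairs of adjacent vertices $u,v$. $X\backslash e$ is obtained from $X$ by deleting the edge $e$. Adjacency cospectral means the adjacency matrices have the same characteristic polynomial. *)

theory Defs
  imports "Graph_Theory.Pair_Digraph" "Jordan_Normal_Form.Char_Poly"
begin

text \<open>Finite simple undirected graphs are the instances of the locale \<open>pair_graph\<close>: finite,
  loop-free digraphs with symmetric arc relation. An undirected edge is the vertex set
  \<open>{u, v}\<close>, standing for the two opposite arcs \<open>(u, v)\<close> and \<open>(v, u)\<close>.\<close>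

definition uedges :: "'a pair_pre_digraph \<Rightarrow> 'a set set" where
  "uedges X = {{u, v} |u v. (u, v) \<in> parcs X}"

definition delete_edge :: "'a pair_pre_digraph \<Rightarrow> 'a set \<Rightarrow> 'a pair_pre_digraph" where
  "delete_edge X e = X\<lparr>parcs := {(u, v) \<in> parcs X. {u, v} \<noteq> e}\<rparr>"

definition num_walks :: "'a pair_pre_digraph \<Rightarrow> nat \<Rightarrow> 'a \<Rightarrow> 'a \<Rightarrow> nat" where
  "num_walks X k u v = card {p. pre_digraph.awalk (with_proj X) u p v \<and> length p = k}"

definition one_walk_regular :: "'a pair_pre_digraph \<Rightarrow> bool" where
  "one_walk_regular X \<longleftrightarrow>
     (\<forall>k>0.
       (\<forall>u\<in>pverts X. \<forall>v\<in>pverts X. num_walks X k u u = num_walks X k v v) \<and>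
       (\<forall>(u, v)\<in>parcs X. \<forall>(x, y)\<in>parcs X. num_walks X k u v = num_walks X k x y))"

text \<open>The adjacency matrix depends on an enumeration \<open>vs\<close> of the vertices.\<close>

definition adjacency_matrix :: "'a pair_pre_digraph \<Rightarrow> 'a list \<Rightarrow> real mat" where
  "adjacency_matrix X vs =
     mat (length vs) (length vs) (\<lambda>(i, j). if (vs ! i, vs ! j) \<in> parcs X then 1 else 0)"

definition vertex_enum :: "'a pair_pre_digraph \<Rightarrow> 'a list \<Rightarrow> bool" where
  "vertex_enum X vs \<longleftrightarrow> distinct vs \<and> set vs = pverts X"

text \<open>Quantifying over all enumerations makes the notion independent of a choice of ordering; a
  finite graph always has an enumeration, so for finite graphs the condition is not vacuous.\<close>

definition adjacency_cospectral :: "'a pair_pre_digraph \<Rightarrow> 'a pair_pre_digraph \<Rightarrow> bool" where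
  "adjacency_cospectral X Y \<longleftrightarrow>
     (\<forall>vs ws. vertex_enum X vs \<longrightarrow> vertex_enum Y ws \<longrightarrow>
        char_poly (adjacency_matrix X vs) = char_poly (adjacency_matrix Y ws))"

end

theory Submission
  imports Defs
begin

text \<open>Let \<open>A\<close> be the adjacency matrix of \<open>X\<close>, let \<open>\<phi>\<close> be its characteristic polynomial and let
  \<open>R\<close> be the adjugate of \<open>xI - A\<close>. Deleting the edge \<open>{i, j}\<close> adds the matrix \<open>E_ij + E_ji\<close> of rank
  two to \<open>xI - A\<close>, so by the matrix determinant lemma \<open>\<phi>\<close> times the characteristic polynomial of
  the smaller graph is \<open>(\<phi> + R_ij) (\<phi> + R_ji) - R_ii R_jj\<close>. Comparing coefficients in
  \<open>R (xI - A) = \<phi> I\<close> expresses \<open>R_uv\<close> through \<open>\<phi>\<close> and the numbers \<open>(A^l)_uv\<close> of walks from \<open>u\<close>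
  to \<open>v\<close>. In a 1-walk regular graph the product is therefore the same for all edges, and \<open>\<phi>\<close> can
  be cancelled.\<close>

section \<open>Determinants of low-rank updates\<close>

lemma matrix_determinant_lemma_adj:
  fixes N :: "'a :: idom mat"
  assumes N: "N \<in> carrier_mat n n" and U: "U \<in> carrier_mat n m" and V: "V \<in> carrier_mat m n"
  shows "det N ^ m * det (N + U * V) = det N * det (det N \<cdot>\<^sub>m 1\<^sub>m m + V * adj_mat N * U)"
proof -
  define W where "W = V * adj_mat N"
  note adj = adj_mat[OF N]
  have W: "W \<in> carrier_mat m n" and WN: "W * N = det N \<cdot>\<^sub>m V"
    using N V adj by (simp_all add: W_def assoc_mult_mat[OF V adj(1) N]
      mult_smult_distrib[OF V one_carrier_mat])
  let ?M = "four_block_mat N (- U) V (1\<^sub>m m)"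
  let ?K = "four_block_mat (1\<^sub>m n) U (0\<^sub>m m n) (1\<^sub>m m)"
  let ?L = "four_block_mat (1\<^sub>m n) (0\<^sub>m n m) (- W) (det N \<cdot>\<^sub>m 1\<^sub>m m)"
  have M: "?M \<in> carrier_mat (n + m) (n + m)"
    and K: "?K \<in> carrier_mat (n + m) (n + m)"
    and L: "?L \<in> carrier_mat (n + m) (n + m)"
    using N by simp_all
  have "?K * ?M = four_block_mat (N + U * V) (0\<^sub>m n m) V (1\<^sub>m m)"
    using N U V by (subst mult_four_block_mat[where ?n1.0 = n and ?n2.0 = m]) auto
  then have "det ?K * det ?M = det (N + U * V)"
    using N U V
    by (simp add: det_mult[OF K M, symmetric]
        det_four_block_mat_upper_right_zero[where n = n and m = m])
  moreover have "det ?K = 1"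
    using U by (simp add: det_four_block_mat_lower_left_zero[where n = n and m = m])
  ultimately have det_M: "det ?M = det (N + U * V)" by simp
  have "?L * ?M = four_block_mat N (- U) (0\<^sub>m m n) (det N \<cdot>\<^sub>m 1\<^sub>m m + W * U)"
    using N U V W WN
    by (subst mult_four_block_mat[where ?n1.0 = n and ?n2.0 = m])
       (auto simp: mult_smult_assoc_mat[where B = V] comm_add_mat[where nr = m and nc = m])
  then have "det ?L * det ?M = det N * det (det N \<cdot>\<^sub>m 1\<^sub>m m + W * U)"
    using N U W
    by (simp add: det_mult[OF L M, symmetric]
        det_four_block_mat_lower_left_zero[where n = n and m = m])
  moreover have "det ?L = det N ^ m"
    using W by (simp add: det_four_block_mat_upper_right_zero[where n = n and m = m])
  ultimately show ?thesis
    by (simp add: det_M W_def)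
qed

lemma det_carrier_mat_2:
  fixes A :: "'a :: comm_ring_1 mat"
  assumes A: "A \<in> carrier_mat 2 2"
  shows "det A = A $$ (0, 0) * A $$ (1, 1) - A $$ (0, 1) * A $$ (1, 0)"
proof -
  have "det (mat_delete A 0 j) = A $$ (1, 1 - j)" if "j < 2" for j
    using A that by (subst det_single) (auto simp: mat_delete_def less_2_cases_iff)
  then show ?thesis
    by (simp add: laplace_expansion_row[OF A, of 0] cofactor_def numeral_2_eq_2)
qed

definition matrix_unit :: "nat \<Rightarrow> nat \<Rightarrow> nat \<Rightarrow> 'a :: zero_neq_one mat" where
  "matrix_unit n i j = mat n n (\<lambda>(a, b). of_bool (a = i \<and> b = j))"

lemma matrix_unit_dim [simp]: "dim_row (matrix_unit n i j) = n" "dim_col (matrix_unit n i j) = n"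
  by (simp_all add: matrix_unit_def)

lemma matrix_unit_index [simp]:
  "a < n \<Longrightarrow> b < n \<Longrightarrow> matrix_unit n i j $$ (a, b) = of_bool (a = i \<and> b = j)"
  by (simp add: matrix_unit_def)

lemma det_add_two_matrix_units:
  fixes N :: "'a :: idom mat"
  assumes N: "N \<in> carrier_mat n n" and "det N \<noteq> 0"
    and less: "i < n" "j < n" "k < n" "l < n"
  defines "R \<equiv> adj_mat N"
  shows "det N * det (N + (matrix_unit n i j + matrix_unit n k l)) =
    (det N + R $$ (j, i)) * (det N + R $$ (l, k)) - R $$ (j, k) * R $$ (l, i)"
proof -
  define U :: "'a mat" where "U = mat_of_cols n [unit_vec n i, unit_vec n k]"
  define V :: "'a mat" where "V = mat_of_rows n [unit_vec n j, unit_vec n l]"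
  have U: "U \<in> carrier_mat n 2" and V: "V \<in> carrier_mat 2 n"
    unfolding U_def V_def numeral_2_eq_2 by auto
  have R: "R \<in> carrier_mat n n"
    unfolding R_def by (rule adj_mat(1)[OF N])
  define W where "W = V * R"
  have W: "W \<in> carrier_mat 2 n"
    using V R by (simp add: W_def)
  have UV: "U * V = matrix_unit n i j + matrix_unit n k l"
    by (rule eq_matI)
       (auto simp: U_def V_def scalar_prod_def mat_of_cols_index mat_of_rows_index unit_vec_def)
  have W_index: "W $$ (c, b) = R $$ ([j, l] ! c, b)" if "c < 2" "b < n" for c b
    using that R less by (auto simp: W_def V_def less_2_cases_iff)
  have WU_index: "(W * U) $$ (c, d) = R $$ ([j, l] ! c, [i, k] ! d)" if "c < 2" "d < 2" for c d
    using that W less by (auto simp: U_def less_2_cases_iff W_index)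
  have "det N ^ 2 * det (N + U * V) = det N * det (det N \<cdot>\<^sub>m 1\<^sub>m 2 + W * U)"
    unfolding W_def R_def by (rule matrix_determinant_lemma_adj[OF N U V])
  also have "det (det N \<cdot>\<^sub>m 1\<^sub>m 2 + W * U) =
      (det N + R $$ (j, i)) * (det N + R $$ (l, k)) - R $$ (j, k) * R $$ (l, i)"
    using U W WU_index by (subst det_carrier_mat_2) auto
  finally show ?thesis
    using \<open>det N \<noteq> 0\<close> by (simp add: UV power2_eq_square)
qed

section \<open>The adjugate of the characteristic matrix\<close>

lemma char_poly_matrix_index:
  assumes "A \<in> carrier_mat n n" "i < n" "j < n"
  shows "char_poly_matrix A $$ (i, j) = [:- (A $$ (i, j)), of_bool (i = j):]"
  using assms by (cases "i = j") (auto simp: char_poly_matrix_def)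

lemma coeff_adj_char_poly_matrix_recursion:
  assumes A: "A \<in> carrier_mat n n" and ij: "i < n" "j < n"
  defines "R \<equiv> adj_mat (char_poly_matrix A)"
  shows "coeff (R $$ (i, j)) k = of_bool (i = j) * coeff (char_poly A) (Suc k) +
    (\<Sum>h<n. coeff (R $$ (i, h)) (Suc k) * A $$ (h, j))"
proof -
  let ?C = "char_poly_matrix A"
  have C: "?C \<in> carrier_mat n n" using A by simp
  have R: "R \<in> carrier_mat n n" and RC: "R * ?C = char_poly A \<cdot>\<^sub>m 1\<^sub>m n"
    unfolding R_def char_poly_def using adj_mat[OF C] by auto
  have entry: "R $$ (i, h) * ?C $$ (h, j) =
      pCons 0 (if h = j then R $$ (i, h) else 0) - Polynomial.smult (A $$ (h, j)) (R $$ (i, h))"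
    if "h < n" for h
    using ij that by (simp add: char_poly_matrix_index[OF A])
  have "of_bool (i = j) * coeff (char_poly A) (Suc k) = coeff ((R * ?C) $$ (i, j)) (Suc k)"
    using ij by (simp add: RC)
  also have "(R * ?C) $$ (i, j) = (\<Sum>h<n. R $$ (i, h) * ?C $$ (h, j))"
    using ij R C by (simp add: scalar_prod_def atLeast0LessThan)
  also have "coeff \<dots> (Suc k) = (\<Sum>h<n. (if h = j then coeff (R $$ (i, h)) k else 0) -
      coeff (R $$ (i, h)) (Suc k) * A $$ (h, j))"
    by (auto simp: coeff_sum entry mult.commute intro!: sum.cong)
  also have "\<dots> = coeff (R $$ (i, j)) k - (\<Sum>h<n. coeff (R $$ (i, h)) (Suc k) * A $$ (h, j))"
    using ij by (simp add: sum_subtractf)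
  finally show ?thesis by (simp add: algebra_simps)
qed

lemma sum_pow_mat_recursion:
  fixes A :: "'a :: comm_ring_1 mat"
  assumes A: "A \<in> carrier_mat n n" and ij: "i < n" "j < n" and last: "c (Suc (k + n)) = 0"
  shows "(\<Sum>l<n. (A ^\<^sub>m l) $$ (i, j) * c (k + Suc l)) = of_bool (i = j) * c (Suc k) +
    (\<Sum>h<n. (\<Sum>l<n. (A ^\<^sub>m l) $$ (i, h) * c (Suc k + Suc l)) * A $$ (h, j))"
proof -
  have "(\<Sum>l<n. (A ^\<^sub>m l) $$ (i, j) * c (k + Suc l)) =
      (\<Sum>l<Suc n. (A ^\<^sub>m l) $$ (i, j) * c (k + Suc l))"
    by (simp add: last)
  also have "\<dots> = of_bool (i = j) * c (Suc k) +
      (\<Sum>l<n. (A ^\<^sub>m Suc l) $$ (i, j) * c (Suc k + Suc l))"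
    using A ij unfolding sum.lessThan_Suc_shift by simp
  also have "(\<Sum>l<n. (A ^\<^sub>m Suc l) $$ (i, j) * c (Suc k + Suc l)) =
      (\<Sum>l<n. \<Sum>h<n. (A ^\<^sub>m l) $$ (i, h) * c (Suc k + Suc l) * A $$ (h, j))"
    using A ij by (simp add: scalar_prod_def atLeast0LessThan sum_distrib_left sum_distrib_right
        mult_ac)
  also have "\<dots> = (\<Sum>h<n. (\<Sum>l<n. (A ^\<^sub>m l) $$ (i, h) * c (Suc k + Suc l)) * A $$ (h, j))"
    by (subst sum.swap) (simp add: sum_distrib_right)
  finally show ?thesis .
qed

lemma coeff_char_poly_eq_0:
  assumes "A \<in> carrier_mat n n" "n < k"
  shows "coeff (char_poly A) k = 0"
  using degree_monic_char_poly[OF assms(1)] assms(2) by (auto intro: coeff_eq_0)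

text \<open>Both sides satisfy the same recursion, which computes the \<open>k\<close>-th coefficients from the
  \<open>Suc k\<close>-th ones, and all coefficients of sufficiently high index vanish.\<close>

lemma coeff_adj_char_poly_matrix_eq_sum_pow_mat:
  assumes A: "A \<in> carrier_mat n n" and i: "i < n" and "j < n"
  defines "R \<equiv> adj_mat (char_poly_matrix A)" and "p \<equiv> char_poly A"
  shows "coeff (R $$ (i, j)) k = (\<Sum>l<n. (A ^\<^sub>m l) $$ (i, j) * coeff p (k + Suc l))"
proof -
  define d where "d = n + (\<Sum>h<n. degree (R $$ (i, h)))"
  have coeff_R: "coeff (R $$ (i, j)) k = 0" if "j < n" "d < k" for j k
  proof -
    have "degree (R $$ (i, j)) \<le> d"
      unfolding d_def using that by (intro trans_le_add2 member_le_sum) auto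
    then show ?thesis using that by (simp add: coeff_eq_0)
  qed
  have "\<forall>j<n. coeff (R $$ (i, j)) k = (\<Sum>l<n. (A ^\<^sub>m l) $$ (i, j) * coeff p (k + Suc l))"
  proof (rule inc_induct[of k "k + Suc d"])
    show "\<forall>j<n. coeff (R $$ (i, j)) (k + Suc d) =
        (\<Sum>l<n. (A ^\<^sub>m l) $$ (i, j) * coeff p (k + Suc d + Suc l))"
      by (simp add: coeff_R coeff_char_poly_eq_0[OF A] p_def d_def)
  next
    fix k
    assume IH: "\<forall>j<n. coeff (R $$ (i, j)) (Suc k) =
      (\<Sum>l<n. (A ^\<^sub>m l) $$ (i, j) * coeff p (Suc k + Suc l))"
    show "\<forall>j<n. coeff (R $$ (i, j)) k = (\<Sum>l<n. (A ^\<^sub>m l) $$ (i, j) * coeff p (k + Suc l))"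
    proof (intro allI impI)
      fix j assume j: "j < n"
      have "coeff (R $$ (i, j)) k = of_bool (i = j) * coeff p (Suc k) +
          (\<Sum>h<n. (\<Sum>l<n. (A ^\<^sub>m l) $$ (i, h) * coeff p (Suc k + Suc l)) * A $$ (h, j))"
        using IH coeff_adj_char_poly_matrix_recursion[OF A i j, of k] by (simp add: R_def p_def)
      also have "\<dots> = (\<Sum>l<n. (A ^\<^sub>m l) $$ (i, j) * coeff p (k + Suc l))"
        by (rule sum_pow_mat_recursion[OF A i j, symmetric])
           (simp add: coeff_char_poly_eq_0[OF A] p_def)
      finally show "coeff (R $$ (i, j)) k =
          (\<Sum>l<n. (A ^\<^sub>m l) $$ (i, j) * coeff p (k + Suc l))" .
    qed
  qed simp
  then show ?thesis using \<open>j < n\<close> by simp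
qed

lemma adj_char_poly_matrix_eq_sum_pow_mat:
  assumes "A \<in> carrier_mat n n" "i < n" "j < n"
  shows "adj_mat (char_poly_matrix A) $$ (i, j) =
    (\<Sum>l<n. Polynomial.smult ((A ^\<^sub>m l) $$ (i, j)) (poly_shift (Suc l) (char_poly A)))"
  by (simp add: poly_eq_iff coeff_sum coeff_poly_shift
      coeff_adj_char_poly_matrix_eq_sum_pow_mat[OF assms])

section \<open>Matrices with rows and columns indexed by lists\<close>

definition indexed_mat :: "'a list \<Rightarrow> 'b list \<Rightarrow> ('a \<Rightarrow> 'b \<Rightarrow> 'c) \<Rightarrow> 'c mat" where
  "indexed_mat us vs f = mat (length us) (length vs) (\<lambda>(i, j). f (us ! i) (vs ! j))"

lemma indexed_mat_cong:
  assumes "\<And>u v. u \<in> set us \<Longrightarrow> v \<in> set vs \<Longrightarrow> f u v = g u v"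
  shows "indexed_mat us vs f = indexed_mat us vs g"
  using assms by (auto simp: indexed_mat_def intro!: eq_matI)

lemma indexed_mat_one:
  "distinct vs \<Longrightarrow> indexed_mat vs vs (\<lambda>u v. of_bool (u = v)) = 1\<^sub>m (length vs)"
  by (rule eq_matI) (auto simp: indexed_mat_def nth_eq_iff_index_eq)

lemma indexed_mat_mult:
  fixes f :: "'a \<Rightarrow> 'b \<Rightarrow> 'c :: semiring_0"
  assumes "distinct vs"
  shows "indexed_mat us vs f * indexed_mat vs ws g =
    indexed_mat us ws (\<lambda>u w. \<Sum>v\<in>set vs. f u v * g v w)"
proof (rule eq_matI)
  fix i j
  assume "i < dim_row (indexed_mat us ws (\<lambda>u w. \<Sum>v\<in>set vs. f u v * g v w))"
    "j < dim_col (indexed_mat us ws (\<lambda>u w. \<Sum>v\<in>set vs. f u v * g v w))"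
  moreover have "(\<Sum>k<length vs. f (us ! i) (vs ! k) * g (vs ! k) (ws ! j)) =
      (\<Sum>v\<in>set vs. f (us ! i) v * g v (ws ! j))"
    by (rule sum.reindex_bij_betw[OF bij_betw_nth[OF assms refl refl]])
  ultimately show "(indexed_mat us vs f * indexed_mat vs ws g) $$ (i, j) =
      indexed_mat us ws (\<lambda>u w. \<Sum>v\<in>set vs. f u v * g v w) $$ (i, j)"
    by (simp add: indexed_mat_def scalar_prod_def atLeast0LessThan)
qed (simp_all add: indexed_mat_def)

lemma indexed_mat_delta_mult:
  fixes f :: "'a \<Rightarrow> 'b \<Rightarrow> 'c :: semiring_1"
  assumes "distinct vs" "set us \<subseteq> set vs"
  shows "indexed_mat us vs (\<lambda>u v. of_bool (u = v)) * indexed_mat vs ws f = indexed_mat us ws f"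
proof -
  have "(\<Sum>v\<in>set vs. of_bool (u = v) * f v w) = f u w" if "u \<in> set us" for u w
    using that assms(2) by (subst sum.remove[of _ u]) (auto intro!: sum.neutral)
  then show ?thesis
    by (auto simp: indexed_mat_mult[OF assms(1)] intro: indexed_mat_cong)
qed

lemma indexed_mat_mult_delta:
  fixes f :: "'a \<Rightarrow> 'b \<Rightarrow> 'c :: semiring_1"
  assumes "distinct vs" "set ws \<subseteq> set vs"
  shows "indexed_mat us vs f * indexed_mat vs ws (\<lambda>v w. of_bool (v = w)) = indexed_mat us ws f"
proof -
  have "(\<Sum>v\<in>set vs. f u v * of_bool (v = w)) = f u w" if "w \<in> set ws" for u w
    using that assms(2) by (subst sum.remove[of _ w]) (auto intro!: sum.neutral)
  then show ?thesis
    by (auto simp: indexed_mat_mult[OF assms(1)] intro: indexed_mat_cong)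
qed

lemma similar_mat_indexed_mat:
  fixes f :: "'a \<Rightarrow> 'a \<Rightarrow> 'b :: semiring_1"
  assumes "distinct vs" "distinct ws" "set vs = set ws"
  shows "similar_mat (indexed_mat vs vs f) (indexed_mat ws ws f)"
proof (rule similar_matI)
  let ?\<delta> = "\<lambda>u v. of_bool (u = v) :: 'b"
  have len: "length vs = length ws"
    using assms by (metis distinct_card)
  show "{indexed_mat vs vs f, indexed_mat ws ws f, indexed_mat vs ws ?\<delta>, indexed_mat ws vs ?\<delta>}
      \<subseteq> carrier_mat (length ws) (length ws)"
    using len by (auto simp: indexed_mat_def)
  show "indexed_mat vs ws ?\<delta> * indexed_mat ws vs ?\<delta> = 1\<^sub>m (length ws)"
    "indexed_mat ws vs ?\<delta> * indexed_mat vs ws ?\<delta> = 1\<^sub>m (length ws)"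
    using assms len by (simp_all add: indexed_mat_delta_mult indexed_mat_one)
  show "indexed_mat vs vs f = indexed_mat vs ws ?\<delta> * indexed_mat ws ws f * indexed_mat ws vs ?\<delta>"
    using assms by (simp add: indexed_mat_delta_mult indexed_mat_mult_delta)
qed

section \<open>Walks and powers of the adjacency matrix\<close>

lemma adjacency_matrix_eq_indexed_mat:
  "adjacency_matrix X vs = indexed_mat vs vs (\<lambda>u v. of_bool ((u, v) \<in> parcs X))"
  by (auto simp: adjacency_matrix_def indexed_mat_def)

lemma adjacency_matrix_carrier [simp]:
  "adjacency_matrix X vs \<in> carrier_mat (length vs) (length vs)"
  by (simp add: adjacency_matrix_def)

lemma char_poly_adjacency_matrix_nonzero: "char_poly (adjacency_matrix X vs) \<noteq> 0"
  using degree_monic_char_poly[OF adjacency_matrix_carrier[of X vs]] by auto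

lemma char_poly_adjacency_matrix_enum_indep:
  assumes "vertex_enum X vs" "vertex_enum X ws"
  shows "char_poly (adjacency_matrix X vs) = char_poly (adjacency_matrix X ws)"
  unfolding adjacency_matrix_eq_indexed_mat
  using assms by (intro char_poly_similar similar_mat_indexed_mat) (auto simp: vertex_enum_def)

lemma num_walks_0: "num_walks X 0 u v = of_bool (u = v \<and> u \<in> pverts X)"
proof -
  have "{p. pre_digraph.awalk (with_proj X) u p v \<and> length p = 0} =
      (if u = v \<and> u \<in> pverts X then {[]} else {})"
    by (auto simp: pre_digraph.awalk_def pre_digraph.cas.simps)
  then show ?thesis by (simp add: num_walks_def)
qed

lemma (in pair_fin_digraph) num_walks_Suc:
  "num_walks G (Suc k) u v = (\<Sum>w\<in>pverts G. of_bool ((u, w) \<in> parcs G) * num_walks G k w v)"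
proof -
  let ?W = "\<lambda>k u. {p. awalk u p v \<and> length p = k}"
  let ?N = "{w \<in> pverts G. (u, w) \<in> parcs G}"
  have finite: "finite (?W k w)" for w
    by (rule finite_subset[OF _ finite_lists_length_eq[OF pair_finite_arcs, of k]])
       (auto simp: awalk_def)
  have "?W (Suc k) u = (\<Union>w\<in>?N. Cons (u, w) ` ?W k w)"
    by (auto simp: length_Suc_conv awalk_Cons_iff image_iff dest: in_arcsD2)
  then have "num_walks G (Suc k) u v = card (\<Union>w\<in>?N. Cons (u, w) ` ?W k w)"
    by (simp add: num_walks_def)
  also have "\<dots> = (\<Sum>w\<in>?N. card (Cons (u, w) ` ?W k w))"
    using pair_finite_verts finite by (intro card_UN_disjoint) auto
  also have "\<dots> = (\<Sum>w\<in>?N. num_walks G k w v)"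
    by (simp add: num_walks_def card_image)
  finally show ?thesis
    using pair_finite_verts by (simp add: Int_def)
qed

lemma pow_mat_Suc2:
  fixes A :: "'a :: semiring_1 mat"
  assumes A: "A \<in> carrier_mat n n"
  shows "A ^\<^sub>m Suc k = A * A ^\<^sub>m k"
proof -
  interpret semiring "ring_mat TYPE('a) n ()" by (rule semiring_mat)
  show ?thesis
    using nat_pow_Suc2[of A k] A by (simp add: pow_mat_ring_pow[OF A, of _ "()"] ring_mat_def)
qed

lemma (in pair_fin_digraph) adjacency_matrix_pow:
  assumes "vertex_enum G vs"
  shows "adjacency_matrix G vs ^\<^sub>m k = indexed_mat vs vs (\<lambda>u v. real (num_walks G k u v))"
proof (induction k)
  case 0
  have "indexed_mat vs vs (\<lambda>u v. real (num_walks G 0 u v)) =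
      indexed_mat vs vs (\<lambda>u v. of_bool (u = v))"
    using assms by (auto simp: num_walks_0 vertex_enum_def intro: indexed_mat_cong)
  then show ?case
    using assms by (simp add: indexed_mat_one vertex_enum_def adjacency_matrix_def)
next
  case (Suc k)
  have "adjacency_matrix G vs ^\<^sub>m Suc k = adjacency_matrix G vs * adjacency_matrix G vs ^\<^sub>m k"
    by (rule pow_mat_Suc2) (rule adjacency_matrix_carrier)
  also have "\<dots> = indexed_mat vs vs (\<lambda>u v. real (num_walks G (Suc k) u v))"
    using assms unfolding Suc.IH unfolding adjacency_matrix_eq_indexed_mat
    by (simp add: indexed_mat_mult num_walks_Suc vertex_enum_def)
  finally show ?case .
qed

section \<open>The characteristic polynomial after deleting an edge\<close>

text \<open>The polynomial part of \<open>p(x)\<close> times the walk generating function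
  \<open>\<Sum>l. num_walks X l u v / x ^ (l + 1)\<close>.\<close>

definition walk_poly :: "'a pair_pre_digraph \<Rightarrow> real poly \<Rightarrow> 'a \<Rightarrow> 'a \<Rightarrow> real poly" where
  "walk_poly X p u v =
    (\<Sum>l<degree p. Polynomial.smult (real (num_walks X l u v)) (poly_shift (Suc l) p))"

lemma (in pair_fin_digraph) adj_char_poly_matrix_adjacency_matrix:
  assumes "vertex_enum G vs" and "i < length vs" "j < length vs"
  shows "adj_mat (char_poly_matrix (adjacency_matrix G vs)) $$ (i, j) =
    walk_poly G (char_poly (adjacency_matrix G vs)) (vs ! i) (vs ! j)"
  using assms degree_monic_char_poly[OF adjacency_matrix_carrier[of G vs]]
  by (simp add: adj_char_poly_matrix_eq_sum_pow_mat[where n = "length vs"] adjacency_matrix_pow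
      walk_poly_def) (simp add: indexed_mat_def)

lemma (in pair_sym_digraph) parcs_sym: "(u, v) \<in> parcs G \<Longrightarrow> (v, u) \<in> parcs G"
  using pair_sym_arcs by (auto simp: symmetric_def dest: symD)

lemma (in pair_sym_digraph) char_poly_matrix_delete_edge:
  assumes "distinct vs" and less: "i < length vs" "j < length vs" "i \<noteq> j"
    and arc: "(vs ! i, vs ! j) \<in> parcs G"
  shows "char_poly_matrix (adjacency_matrix (delete_edge G {vs ! i, vs ! j}) vs) =
    char_poly_matrix (adjacency_matrix G vs) +
      (matrix_unit (length vs) i j + matrix_unit (length vs) j i)" (is "_ = ?M + ?E")
proof (rule eq_matI)
  fix a b assume "a < dim_row (?M + ?E)" "b < dim_col (?M + ?E)"
  then have ab: "a < length vs" "b < length vs" by auto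
  have "{vs ! a, vs ! b} = {vs ! i, vs ! j} \<longleftrightarrow> a = i \<and> b = j \<or> a = j \<and> b = i"
    using assms ab by (auto simp: doubleton_eq_iff nth_eq_iff_index_eq)
  then show "char_poly_matrix (adjacency_matrix (delete_edge G {vs ! i, vs ! j}) vs) $$ (a, b) =
      (?M + ?E) $$ (a, b)"
    using ab less arc parcs_sym[OF arc]
    by (auto simp: char_poly_matrix_index[where n = "length vs"] adjacency_matrix_def delete_edge_def
        one_pCons)
qed (simp_all add: char_poly_matrix_def adjacency_matrix_def)

lemma (in pair_graph) char_poly_delete_edge:
  assumes vs: "vertex_enum G vs" and uv: "(u, v) \<in> parcs G"
  defines "p \<equiv> char_poly (adjacency_matrix G vs)"
  shows "p * char_poly (adjacency_matrix (delete_edge G {u, v}) vs) =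
    (p + walk_poly G p u v) * (p + walk_poly G p v u) - walk_poly G p u u * walk_poly G p v v"
proof -
  let ?N = "char_poly_matrix (adjacency_matrix G vs)"
  have "distinct vs" and set: "set vs = pverts G"
    using vs by (auto simp: vertex_enum_def)
  obtain i j where ij: "i < length vs" "j < length vs" and nth: "vs ! i = u" "vs ! j = v"
    using in_arcsD1[OF uv] in_arcsD2[OF uv] unfolding set[symmetric]
    by (auto simp: in_set_conv_nth)
  have "i \<noteq> j"
    using pair_no_loops[OF uv] nth by auto
  have N: "?N \<in> carrier_mat (length vs) (length vs)"
    by (intro char_poly_matrix_closed adjacency_matrix_carrier)
  have det_N: "det ?N = p"
    by (simp add: p_def char_poly_def)
  have R: "adj_mat ?N $$ (a, b) = walk_poly G p (vs ! a) (vs ! b)"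
    if "a < length vs" "b < length vs" for a b
    unfolding p_def by (rule adj_char_poly_matrix_adjacency_matrix[OF vs that])
  have "p * char_poly (adjacency_matrix (delete_edge G {u, v}) vs) =
      det ?N * det (?N + (matrix_unit (length vs) i j + matrix_unit (length vs) j i))"
    using char_poly_matrix_delete_edge[OF \<open>distinct vs\<close> ij \<open>i \<noteq> j\<close>] uv nth
    by (simp add: det_N) (simp add: char_poly_def)
  also have "\<dots> = (det ?N + adj_mat ?N $$ (j, i)) * (det ?N + adj_mat ?N $$ (i, j)) -
      adj_mat ?N $$ (j, j) * adj_mat ?N $$ (i, i)"
    using N ij char_poly_adjacency_matrix_nonzero[of G vs]
    by (intro det_add_two_matrix_units) (simp_all add: char_poly_def)
  finally show ?thesis
    using ij nth by (simp add: R det_N mult.commute)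
qed

lemma one_walk_regular_walk_poly_diag:
  assumes "one_walk_regular X" "u \<in> pverts X" "v \<in> pverts X"
  shows "walk_poly X p u u = walk_poly X p v v"
proof -
  have "num_walks X k u u = num_walks X k v v" for k
    using assms unfolding one_walk_regular_def by (cases "k = 0") (simp add: num_walks_0, blast)
  then show ?thesis by (simp add: walk_poly_def)
qed

lemma (in pair_loopfree_digraph) one_walk_regular_walk_poly_arc:
  assumes "one_walk_regular G" "(u, v) \<in> parcs G" "(y, z) \<in> parcs G"
  shows "walk_poly G p u v = walk_poly G p y z"
proof -
  have "num_walks G k u v = num_walks G k y z" for k
    using assms pair_no_loops[OF assms(2)] pair_no_loops[OF assms(3)]
    unfolding one_walk_regular_def by (cases "k = 0") (simp add: num_walks_0, blast)
  then show ?thesis by (simp add: walk_poly_def)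
qed

lemma (in pair_graph) one_walk_regular_char_poly_delete_edge:
  assumes "one_walk_regular G" "vertex_enum G vs" "(u, v) \<in> parcs G" "(y, z) \<in> parcs G"
  shows "char_poly (adjacency_matrix (delete_edge G {u, v}) vs) =
    char_poly (adjacency_matrix (delete_edge G {y, z}) vs)"
proof -
  let ?p = "char_poly (adjacency_matrix G vs)"
  have "walk_poly G ?p u v = walk_poly G ?p y z"
    using assms(1,3,4) by (rule one_walk_regular_walk_poly_arc)
  moreover have "walk_poly G ?p v u = walk_poly G ?p z y"
    using assms(1) parcs_sym[OF assms(3)] parcs_sym[OF assms(4)]
    by (rule one_walk_regular_walk_poly_arc)
  moreover have "walk_poly G ?p u u = walk_poly G ?p y y"
    using assms(1) in_arcsD1[OF assms(3)] in_arcsD1[OF assms(4)]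
    by (rule one_walk_regular_walk_poly_diag)
  moreover have "walk_poly G ?p v v = walk_poly G ?p z z"
    using assms(1) in_arcsD2[OF assms(3)] in_arcsD2[OF assms(4)]
    by (rule one_walk_regular_walk_poly_diag)
  ultimately have "?p * char_poly (adjacency_matrix (delete_edge G {u, v}) vs) =
      ?p * char_poly (adjacency_matrix (delete_edge G {y, z}) vs)"
    by (simp only: char_poly_delete_edge[OF assms(2,3)] char_poly_delete_edge[OF assms(2,4)])
  then show ?thesis
    by (simp add: char_poly_adjacency_matrix_nonzero)
qed

theorem theorem3p2:
  fixes X :: "'a pair_pre_digraph" and e f :: "'a set"
  assumes "pair_graph X"
    and "one_walk_regular X"
    and "e \<in> uedges X"
    and "f \<in> uedges X"
  shows "adjacency_cospectral (delete_edge X e) (delete_edge X f)"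
  unfolding adjacency_cospectral_def
proof (intro allI impI)
  interpret pair_graph X by fact
  fix vs ws assume "vertex_enum (delete_edge X e) vs" and ws: "vertex_enum (delete_edge X f) ws"
  then have "vertex_enum X vs" and "vertex_enum (delete_edge X f) vs"
    by (auto simp: vertex_enum_def delete_edge_def)
  obtain u v y z where e: "e = {u, v}" "(u, v) \<in> parcs X" and f: "f = {y, z}" "(y, z) \<in> parcs X"
    using assms(3,4) by (auto simp: uedges_def)
  have "char_poly (adjacency_matrix (delete_edge X e) vs) =
      char_poly (adjacency_matrix (delete_edge X f) vs)"
    unfolding e(1) f(1)
    using assms(2) \<open>vertex_enum X vs\<close> e(2) f(2) by (rule one_walk_regular_char_poly_delete_edge)
  also have "\<dots> = char_poly (adjacency_matrix (delete_edge X f) ws)"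
    using \<open>vertex_enum (delete_edge X f) vs\<close> ws by (rule char_poly_adjacency_matrix_enum_indep)
  finally show "char_poly (adjacency_matrix (delete_edge X e) vs) =
      char_poly (adjacency_matrix (delete_edge X f) ws)" .
qed

end
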